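(* Let $G$ be a finite connected simple graph with $m\ge 1$ edges, with vertex set $\{x_1,\ldots,x_n\}$, let $K$ be a field and let $I(G)\subset S=K[x_1,\ldots,x_n]$ be its edge ideal. Then $\mathrm v(I(G)^k)=2k-1$ for all $k\geq m+1$.
   Context: $S=\bigoplus_{d\ge 0}S_d$ is graded with $\deg x_i=1$; vertices of $G$ are identified with variables. The edge ideal is $I(G)=\langle x_ix_j\mid \{x_i,x_j\}\in E(G)\rangle$. For a proper graded ideal $I\subset S$, $\mathrm{v}(I):=\min\{d\geq 0\mid \exists f\in S_d,\ \mathfrak{p}\in\operatorname{Ass}(I)\text{ with }(I:f)=\mathfrak{p}\}$, where $\operatorname{Ass}(I)$ is the set of associated primes of $S/I$ and $(I:f)=\{g\in S\mid gf\in I\}$. *)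

theory Defs
  imports
    "HOL-Library.Poly_Mapping"
    "HOL-Library.Extended_Nat"
    "HOL-Algebra.Algebraic_Closure_Type"
    "HOL-Algebra.Ideal_Product"
begin

text \<open>The vertex set of a graph is the whole of a finite type; a graph is given by its edge set.\<close>

definition simple_graph :: "'v::finite set set \<Rightarrow> bool" where
  "simple_graph E \<longleftrightarrow> (\<forall>e\<in>E. card e = 2)"

definition connected_graph :: "'v::finite set set \<Rightarrow> bool" where
  "connected_graph E \<longleftrightarrow> (\<forall>u v. (u, v) \<in> {(x, y). {x, y} \<in> E}\<^sup>*)"

text \<open>
  Polynomials are finitely supported maps from monomials to coefficients, and monomials are
  finitely supported exponent maps. All ideals below are ideals, in the sense of HOL-Algebra,
  of the ring of all such polynomials.
\<close>

type_synonym ('v, 'k) mpoly = "('v \<Rightarrow>\<^sub>0 nat) \<Rightarrow>\<^sub>0 'k"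

abbreviation mpoly_ring :: "('v, 'k::field) mpoly ring" where
  "mpoly_ring \<equiv> ring_of_type_algebra"

definition indet :: "'v \<Rightarrow> ('v, 'k::field) mpoly" where
  "indet v = Poly_Mapping.single (Poly_Mapping.single v 1) 1"

definition graded_part :: "nat \<Rightarrow> ('v, 'k::field) mpoly set" where
  "graded_part d =
    {f. \<forall>t\<in>Poly_Mapping.keys f. (\<Sum>v\<in>Poly_Mapping.keys t. Poly_Mapping.lookup t v) = d}"

definition edge_ideal :: "'v::finite set set \<Rightarrow> ('v, 'k::field) mpoly set" where
  "edge_ideal E = genideal mpoly_ring {indet u * indet v | u v. {u, v} \<in> E}"

text \<open>The power is taken in the monoid of ideals under the ideal product.\<close>

definition ideal_power :: "('a, 'b) ring_scheme \<Rightarrow> 'a set \<Rightarrow> nat \<Rightarrow> 'a set" where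
  "ideal_power R I k = I [^]\<^bsub>ideals_set R\<^esub> k"

definition colon_ideal :: "('a, 'b) ring_scheme \<Rightarrow> 'a set \<Rightarrow> 'a \<Rightarrow> 'a set" where
  "colon_ideal R I f = {g \<in> carrier R. g \<otimes>\<^bsub>R\<^esub> f \<in> I}"

text \<open>
  The associated primes of the module R/I: the prime ideals that are annihilators of an
  element of R/I; the annihilator of the class of f is the colon ideal of I by f.
\<close>

definition associated_primes :: "('a, 'b) ring_scheme \<Rightarrow> 'a set \<Rightarrow> 'a set set" where
  "associated_primes R I =
    {P. primeideal P R \<and> (\<exists>f\<in>carrier R. P = colon_ideal R I f)}"

text \<open>
  The infimum in the extended naturals is the minimum of a nonempty set and infinity on the
  empty set, so a finite value includes the claim that the minimum is attained.
\<close>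

definition v_number :: "('v, 'k::field) mpoly set \<Rightarrow> enat" where
  "v_number I = Inf {enat d | d.
    \<exists>f\<in>graded_part d. \<exists>P\<in>associated_primes mpoly_ring I. colon_ideal mpoly_ring I f = P}"

end

theory Submission
  imports Defs
begin

text \<open>
  The power \<open>I(G)\<^sup>k\<close> is the monomial ideal generated by the products of \<open>k\<close> edges
  (\<open>ideal_power_edge_ideal\<close>), so it lives in degrees at least \<open>2k\<close>.

  Lower bound (\<open>colon_degree_lower_bound\<close>). If \<open>(I(G)\<^sup>k : f)\<close> is a prime \<open>P\<close>, then \<open>P\<close> contains
  \<open>(uv)\<^sup>k\<close> for any edge \<open>uv\<close>, hence contains a variable \<open>w\<close>. Then \<open>w f\<close> is a nonzero element of
  \<open>I(G)\<^sup>k\<close>, which forces \<open>deg f + 1 \<ge> 2k\<close>.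

  Upper bound (\<open>exists_colon_variables\<close>). For a suitable vertex \<open>x\<close>, take for \<open>f\<close> the product of
  \<open>x\<close>, of all \<open>m\<close> edges of \<open>G\<close>, and of any \<open>k - 1 - m\<close> further edges; its degree is \<open>2k - 1\<close>.
  If a walk \<open>x = p\<^sub>0, p\<^sub>1, \<dots>, p\<^sub>l = y\<close> of odd length does not repeat an edge, then multiplying
  \<open>f\<close> by \<open>y\<close> allows the edges in the even places of the walk to be exchanged for those in the
  odd places, which are one more; so \<open>y f\<close> is a product of \<open>k\<close> edges and \<open>y \<in> (I(G)\<^sup>k : f)\<close>.
  This is where \<open>k \<ge> m + 1\<close> enters: \<open>f\<close> contains every edge that could have to be exchanged.

  To find enough such walks, take a spanning tree with its proper two-colouring
  (\<open>spanning_coloured_tree\<close>). If the colouring is proper on all of \<open>G\<close>, the tree paths from any \<open>x\<close>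
  reach all vertices \<open>y\<close> of the other colour class \<open>Y\<close>. As every edge has exactly one end in \<open>Y\<close>,
  the degree in the variables of \<open>Y\<close> is \<open>k - 1\<close> for \<open>f\<close> and at least \<open>k\<close> on \<open>I(G)\<^sup>k\<close>, so
  \<open>(I(G)\<^sup>k : f)\<close> is the prime generated by \<open>Y\<close>. Otherwise some edge \<open>ab\<close> outside the tree joins two
  vertices of the same colour. From \<open>x = a\<close> every vertex is now reached by an odd walk without
  repeated edges, along the tree or first through \<open>ab\<close> and then along the tree, so
  \<open>(I(G)\<^sup>k : f)\<close> is the ideal of all variables, \<open>f\<close> itself having too small a degree to lie in
  \<open>I(G)\<^sup>k\<close>. Both cases are an instance of one degree argument in which every edge has the same
  number \<open>d\<close> of ends in \<open>Y\<close>.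
\<close>

abbreviation keys :: "('a \<Rightarrow>\<^sub>0 'b::zero) \<Rightarrow> 'a set" where
  "keys \<equiv> Poly_Mapping.keys"

abbreviation lookup :: "('a \<Rightarrow>\<^sub>0 'b::zero) \<Rightarrow> 'a \<Rightarrow> 'b" where
  "lookup \<equiv> Poly_Mapping.lookup"

abbreviation single :: "'a \<Rightarrow> 'b \<Rightarrow> ('a \<Rightarrow>\<^sub>0 'b::zero)" where
  "single \<equiv> Poly_Mapping.single"

section \<open>Monomials and products of polynomials\<close>

text \<open>
  The coefficient of a product at a monomial that arises in only one way has no cancellation.
  This applies to multiplication by a monomial and to products of leading monomials.
\<close>

lemma lookup_mult_unique:
  fixes f g :: "('v, 'k::field) mpoly"
  assumes "\<And>a b. \<lbrakk>a \<in> keys f; b \<in> keys g; a + b = s + t\<rbrakk> \<Longrightarrow> a = s \<and> b = t"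
  shows "lookup (f * g) (s + t) = lookup f s * lookup g t"
proof -
  define f' g' where "f' = f - single s (lookup f s)" and "g' = g - single t (lookup g t)"
  have kf: "keys f' \<subseteq> keys f - {s}" and kg: "keys g' \<subseteq> keys g - {t}"
    by (auto simp: f'_def g'_def in_keys_iff lookup_minus lookup_single when_def split: if_splits)
  have "f * g = single (s + t) (lookup f s * lookup g t) + single s (lookup f s) * g' + f' * g"
    by (simp add: f'_def g'_def algebra_simps flip: mult_single)
  moreover have "s + t \<notin> keys (f' * g)"
    using keys_mult[of f' g] kf assms by fastforce
  moreover have "s + t \<notin> keys (single s (lookup f s) * g')"
  proof
    assume "s + t \<in> keys (single s (lookup f s) * g')"
    then obtain a b where "s + t = a + b" "a \<in> keys (single s (lookup f s))" "b \<in> keys g'"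
      using keys_mult[of "single s (lookup f s)" g'] by blast
    with kg show False by (auto split: if_splits)
  qed
  ultimately show ?thesis
    by (simp add: lookup_add in_keys_iff)
qed

lemma keys_mult_monomial:
  fixes g :: "('v, 'k::field) mpoly"
  shows "keys (g * single s 1) = (\<lambda>t. t + s) ` keys g"
proof
  show "keys (g * single s 1) \<subseteq> (\<lambda>t. t + s) ` keys g"
    using keys_mult[of g "single s 1"] by auto
  have "lookup (g * single s 1) (t + s) = lookup g t" for t
    by (subst lookup_mult_unique) auto
  then show "(\<lambda>t. t + s) ` keys g \<subseteq> keys (g * single s 1)"
    by (auto simp: in_keys_iff)
qed

text \<open>
  Exponents indexed by \<^typ>\<open>nat\<close> carry a lexicographic order compatible with addition. A numbering of
  the variables transports it to monomials in an arbitrary finite set of variables, which then have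
  leading monomials.
\<close>

lemma additive_injection_of_monomials:
  "\<exists>h :: ('v::finite \<Rightarrow>\<^sub>0 nat) \<Rightarrow> (nat \<Rightarrow>\<^sub>0 nat). inj h \<and> (\<forall>s t. h (s + t) = h s + h t)"
proof -
  obtain i :: "'v \<Rightarrow> nat" where i: "inj i"
    using finite_imp_inj_to_nat_seg[of "UNIV :: 'v set"] by auto
  define h :: "('v \<Rightarrow>\<^sub>0 nat) \<Rightarrow> (nat \<Rightarrow>\<^sub>0 nat)"
    where "h t = (\<Sum>v\<in>UNIV. single (i v) (lookup t v))" for t
  have "lookup (h t) (i v) = lookup t v" for t v
  proof -
    have "lookup (h t) (i v) = (\<Sum>w\<in>UNIV. if w = v then lookup t w else 0)"
      unfolding h_def lookup_sum
      by (intro sum.cong) (auto simp: lookup_single when_def inj_eq[OF i])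
    then show ?thesis by simp
  qed
  then have "inj h"
    by (intro injI poly_mapping_eqI) metis
  moreover have "h (s + t) = h s + h t" for s t
    by (simp add: h_def lookup_add single_add sum.distrib)
  ultimately show ?thesis by blast
qed

section \<open>Monomial ideals\<close>

lemma mpoly_ring_simps [simp]:
  "carrier mpoly_ring = UNIV"
  "x \<otimes>\<^bsub>mpoly_ring\<^esub> y = x * y" "x \<oplus>\<^bsub>mpoly_ring\<^esub> y = x + y"
  "\<one>\<^bsub>mpoly_ring\<^esub> = 1" "\<zero>\<^bsub>mpoly_ring\<^esub> = 0"
  for x y :: "('v, 'k::field) mpoly"
  by (simp_all add: ring_of_type_algebra_def)

interpretation mpoly: cring "mpoly_ring :: ('v, 'k::field) mpoly ring"
  by (rule cring_from_type_algebra)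

lemma ideal_mpolyI:
  fixes I :: "('v, 'k::field) mpoly set"
  assumes "0 \<in> I" and "\<And>f g. f \<in> I \<Longrightarrow> g \<in> I \<Longrightarrow> f + g \<in> I"
    and "\<And>f g. f \<in> I \<Longrightarrow> g * f \<in> I"
  shows "ideal I mpoly_ring"
proof (rule idealI)
  show "ring (mpoly_ring :: ('v, 'k) mpoly ring)" ..
  show "subgroup I (add_monoid mpoly_ring)"
  proof (rule group.subgroupI)
    show "group (add_monoid (mpoly_ring :: ('v, 'k) mpoly ring))"
      by (rule mpoly.a_group)
    fix f assume f: "f \<in> I"
    have "inv\<^bsub>add_monoid mpoly_ring\<^esub> f = - f"
      using mpoly.minus_equality[of "- f" f] by (simp add: a_inv_def)
    then show "inv\<^bsub>add_monoid mpoly_ring\<^esub> f \<in> I"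
      using assms(3)[OF f, of "- 1"] by simp
  qed (use assms in auto)
qed (use assms(3) in \<open>auto simp: mult.commute\<close>)

lemma ideal_zero: "ideal I mpoly_ring \<Longrightarrow> (0 :: ('v, 'k::field) mpoly) \<in> I"
  using additive_subgroup.zero_closed[OF ideal.axioms(1)] by fastforce

lemma ideal_add:
  "ideal I mpoly_ring \<Longrightarrow> f \<in> I \<Longrightarrow> g \<in> I \<Longrightarrow> f + (g :: ('v, 'k::field) mpoly) \<in> I"
  using additive_subgroup.a_closed[OF ideal.axioms(1)] by fastforce

lemma ideal_mult:
  "ideal I mpoly_ring \<Longrightarrow> f \<in> I \<Longrightarrow> g * (f :: ('v, 'k::field) mpoly) \<in> I"
  using ideal.I_l_closed by fastforce

definition monomial_ideal :: "('v \<Rightarrow>\<^sub>0 nat) set \<Rightarrow> ('v, 'k::field) mpoly set" where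
  "monomial_ideal M = {f. \<forall>t\<in>keys f. \<exists>s\<in>M. \<exists>r. t = s + r}"

lemma ideal_monomial_ideal: "ideal (monomial_ideal M :: ('v, 'k::field) mpoly set) mpoly_ring"
proof (rule ideal_mpolyI)
  fix f g :: "('v, 'k) mpoly"
  assume f: "f \<in> monomial_ideal M"
  { assume "g \<in> monomial_ideal M"
    with f show "f + g \<in> monomial_ideal M"
      using keys_add[of f g] by (auto simp: monomial_ideal_def) }
  show "g * f \<in> monomial_ideal M"
    unfolding monomial_ideal_def
  proof (intro CollectI ballI)
    fix t assume "t \<in> keys (g * f)"
    then obtain a b where "t = a + b" "b \<in> keys f"
      using keys_mult[of g f] by blast
    moreover from f this(2) obtain s r where "s \<in> M" "b = s + r"
      by (auto simp: monomial_ideal_def)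
    ultimately show "\<exists>s\<in>M. \<exists>r. t = s + r"
      by (intro bexI[of _ s] exI[of _ "a + r"]) (auto simp: ac_simps)
  qed
qed (simp add: monomial_ideal_def)

lemma monomial_in_monomial_ideal:
  "s \<in> M \<Longrightarrow> single (s + r) c \<in> monomial_ideal M"
  by (auto simp: monomial_ideal_def)

text \<open>
  Split a polynomial into its terms: each term is a multiple of a generator.
\<close>

lemma monomial_ideal_least:
  fixes J :: "('v, 'k::field) mpoly set"
  assumes J: "ideal J mpoly_ring" and gens: "\<And>s. s \<in> M \<Longrightarrow> single s 1 \<in> J"
  shows "monomial_ideal M \<subseteq> J"
proof
  fix f :: "('v, 'k) mpoly" assume f: "f \<in> monomial_ideal M"
  have "(\<Sum>t\<in>A. single t (lookup f t)) \<in> J" if "finite A" "A \<subseteq> keys f" for A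
    using that
  proof (induction A rule: finite_induct)
    case (insert t A)
    with f obtain s r where "s \<in> M" "t = s + r"
      by (auto simp: monomial_ideal_def)
    then have "single t (lookup f t) = single r (lookup f t) * single s 1"
      by (simp add: mult_single ac_simps)
    with insert gens[OF \<open>s \<in> M\<close>] show ?case
      by (simp add: ideal_add[OF J] ideal_mult[OF J])
  qed (simp add: ideal_zero[OF J])
  moreover have "(\<Sum>t\<in>keys f. single t (lookup f t)) = f"
    by (rule poly_mapping_eqI) (auto simp: lookup_sum lookup_single when_def in_keys_iff)
  ultimately show "f \<in> J"
    by (metis finite_keys subset_refl)
qed

lemma genideal_monomials:
  "genideal mpoly_ring ((\<lambda>s. single s 1) ` M) = (monomial_ideal M :: ('v, 'k::field) mpoly set)"
proof
  have "single s 1 \<in> (monomial_ideal M :: ('v, 'k) mpoly set)" if "s \<in> M" for s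
    using monomial_in_monomial_ideal[OF that, of 0] by simp
  then show "genideal mpoly_ring ((\<lambda>s. single s 1) ` M) \<subseteq> (monomial_ideal M :: ('v, 'k) mpoly set)"
    by (intro mpoly.genideal_minimal ideal_monomial_ideal) auto
  show "monomial_ideal M \<subseteq> genideal mpoly_ring ((\<lambda>s. single s (1 :: 'k)) ` M)"
    using mpoly.genideal_self[of "(\<lambda>s. single s 1) ` M"]
    by (intro monomial_ideal_least mpoly.genideal_ideal) auto
qed

lemma ideal_prod_monomial_ideal:
  "ideal_prod mpoly_ring (monomial_ideal M) (monomial_ideal N)
    = (monomial_ideal {s + t | s t. s \<in> M \<and> t \<in> N} :: ('v, 'k::field) mpoly set)"
  (is "?P = ?Q")
proof
  have prod: "f * g \<in> ?Q" if "f \<in> monomial_ideal M" "g \<in> monomial_ideal N"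
    for f g :: "('v, 'k) mpoly"
    unfolding monomial_ideal_def
  proof (intro CollectI ballI)
    fix t assume "t \<in> keys (f * g)"
    then obtain a b where ab: "t = a + b" "a \<in> keys f" "b \<in> keys g"
      using keys_mult[of f g] by blast
    with that obtain s r s' r' where "s \<in> M" "a = s + r" "s' \<in> N" "b = s' + r'"
      unfolding monomial_ideal_def by blast
    with ab show "\<exists>s\<in>{s + t | s t. s \<in> M \<and> t \<in> N}. \<exists>r. t = s + r"
      by (intro bexI[of _ "s + s'"] exI[of _ "r + r'"]) (auto simp: ac_simps)
  qed
  show "?P \<subseteq> ?Q"
  proof
    fix f assume "f \<in> ?P"
    then show "f \<in> ?Q"
      by induction (simp_all add: prod ideal_add[OF ideal_monomial_ideal])
  qed
  show "?Q \<subseteq> ?P"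
  proof (rule monomial_ideal_least)
    show "ideal ?P mpoly_ring"
      by (intro mpoly.ideal_prod_is_ideal ideal_monomial_ideal)
    fix u assume "u \<in> {s + t | s t. s \<in> M \<and> t \<in> N}"
    then obtain s t where u: "u = s + t" "s \<in> M" "t \<in> N" by blast
    have "single s 1 \<in> (monomial_ideal M :: ('v, 'k) mpoly set)"
      and "single t 1 \<in> (monomial_ideal N :: ('v, 'k) mpoly set)"
      using u monomial_in_monomial_ideal[of _ _ 0] by (metis add.right_neutral)+
    from ideal_prod.prod[OF this, of mpoly_ring] show "single u 1 \<in> ?P"
      by (simp add: mult_single u)
  qed
qed

lemma colon_monomial_ideal:
  "colon_ideal mpoly_ring (monomial_ideal M) (single s 1)
    = {g :: ('v, 'k::field) mpoly. \<forall>t\<in>keys g. \<exists>r\<in>M. \<exists>q. t + s = r + q}"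
  by (simp add: colon_ideal_def monomial_ideal_def keys_mult_monomial)

text \<open>
  An ideal generated by variables is prime because the quotient is a polynomial ring in the
  remaining variables. In terms of monomials: for two polynomials outside the ideal, the leading
  monomials of their \<open>Y\<close>-free parts multiply to a \<open>Y\<close>-free monomial of the product.
\<close>

lemma primeideal_variables:
  fixes Y :: "'v::finite set"
  shows "primeideal {g :: ('v, 'k::field) mpoly. \<forall>t\<in>keys g. keys t \<inter> Y \<noteq> {}} mpoly_ring"
    (is "primeideal ?P _")
proof (rule primeidealI)
  show "cring (mpoly_ring :: ('v, 'k) mpoly ring)" ..
  have "?P = monomial_ideal ((\<lambda>y. single y 1) ` Y)"
  proof -
    have "keys t \<inter> Y \<noteq> {} \<longleftrightarrow> (\<exists>s\<in>(\<lambda>y. single y 1) ` Y. \<exists>r. t = s + r)" for t :: "'v \<Rightarrow>\<^sub>0 nat"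
    proof
      assume "keys t \<inter> Y \<noteq> {}"
      then obtain y where y: "y \<in> Y" "lookup t y \<noteq> 0"
        by (auto simp: in_keys_iff)
      then have "t = single y 1 + (t - single y 1)"
        by (intro poly_mapping_eqI) (auto simp: lookup_add lookup_minus lookup_single when_def)
      with y show "\<exists>s\<in>(\<lambda>y. single y 1) ` Y. \<exists>r. t = s + r" by blast
    next
      assume "\<exists>s\<in>(\<lambda>y. single y 1) ` Y. \<exists>r. t = s + r"
      then obtain y r where "y \<in> Y" "t = single y 1 + r" by blast
      then have "y \<in> keys t" by (simp add: in_keys_iff lookup_add)
      with \<open>y \<in> Y\<close> show "keys t \<inter> Y \<noteq> {}" by blast
    qed
    then show ?thesis by (auto simp: monomial_ideal_def)
  qed
  then show "ideal ?P mpoly_ring" by (simp add: ideal_monomial_ideal)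
  have "1 \<notin> ?P" by simp
  then show "carrier mpoly_ring \<noteq> ?P" by (metis UNIV_I mpoly_ring_simps(1))
next
  obtain h :: "('v \<Rightarrow>\<^sub>0 nat) \<Rightarrow> (nat \<Rightarrow>\<^sub>0 nat)"
    where h: "inj h" and h_add: "\<And>s t. h (s + t) = h s + h t"
    using additive_injection_of_monomials by blast
  \<comment> \<open>the leading monomial of the part of \<open>f\<close> that is free of \<open>Y\<close>\<close>
  have lead: "\<exists>s\<in>keys f. keys s \<inter> Y = {} \<and> (\<forall>a\<in>keys f. keys a \<inter> Y = {} \<longrightarrow> h a \<le> h s)"
    if "f \<notin> ?P" for f :: "('v, 'k) mpoly"
  proof -
    define A where "A = {a \<in> keys f. keys a \<inter> Y = {}}"
    have A: "finite (h ` A)" "h ` A \<noteq> {}" using that by (auto simp: A_def)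
    from Max_in[OF this] obtain s where "s \<in> A" "h s = Max (h ` A)" by auto
    with A show ?thesis by (auto simp: A_def)
  qed
  fix f g :: "('v, 'k) mpoly"
  assume "f \<otimes>\<^bsub>mpoly_ring\<^esub> g \<in> ?P"
  then have fg: "f * g \<in> ?P" by simp
  show "f \<in> ?P \<or> g \<in> ?P"
  proof (rule ccontr)
    assume "\<not> ?thesis"
    then have "f \<notin> ?P" "g \<notin> ?P" by simp_all
    from lead[OF this(1)] obtain s where s: "s \<in> keys f" "keys s \<inter> Y = {}"
      and s_max: "\<And>a. a \<in> keys f \<Longrightarrow> keys a \<inter> Y = {} \<Longrightarrow> h a \<le> h s" by blast
    from lead[OF \<open>g \<notin> ?P\<close>] obtain t where t: "t \<in> keys g" "keys t \<inter> Y = {}"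
      and t_max: "\<And>b. b \<in> keys g \<Longrightarrow> keys b \<inter> Y = {} \<Longrightarrow> h b \<le> h t" by blast
    have free: "keys (s + t) \<inter> Y = {}"
      using s(2) t(2) keys_add[of s t] by blast
    have "lookup (f * g) (s + t) = lookup f s * lookup g t"
    proof (rule lookup_mult_unique)
      fix a b assume ab: "a \<in> keys f" "b \<in> keys g" "a + b = s + t"
      \<comment> \<open>exponents are natural numbers, so a \<open>Y\<close>-free product has \<open>Y\<close>-free factors\<close>
      have "keys a \<subseteq> keys (a + b)" "keys b \<subseteq> keys (a + b)"
        by (auto simp: in_keys_iff lookup_add)
      with free ab(3) have "keys a \<inter> Y = {}" "keys b \<inter> Y = {}" by auto
      then have "h a \<le> h s" "h b \<le> h t"
        using s_max[OF ab(1)] t_max[OF ab(2)] by blast+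
      moreover have "h a + h b = h s + h t"
        by (metis ab(3) h_add)
      ultimately have "h a = h s" "h b = h t"
        using add_less_le_mono[of "h a" "h s" "h b" "h t"] add_le_less_mono[of "h a" "h s" "h b" "h t"]
        by (auto simp: order_le_less)
      then show "a = s \<and> b = t" using h by (simp add: inj_eq)
    qed
    with s t have "s + t \<in> keys (f * g)" by (simp add: in_keys_iff)
    with fg free show False by blast
  qed
qed

section \<open>Powers of the edge ideal\<close>

definition edge_monom :: "'v set \<Rightarrow> ('v \<Rightarrow>\<^sub>0 nat)" where
  "edge_monom e = (\<Sum>v\<in>e. single v 1)"

primrec edge_products :: "'v set set \<Rightarrow> nat \<Rightarrow> ('v \<Rightarrow>\<^sub>0 nat) set" where
  "edge_products E 0 = {0}"
| "edge_products E (Suc k) = {s + edge_monom e | s e. s \<in> edge_products E k \<and> e \<in> E}"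

lemma edge_monom_doubleton: "u \<noteq> v \<Longrightarrow> edge_monom {u, v} = single u 1 + single v 1"
  by (simp add: edge_monom_def)

lemma edge_ideal_eq:
  assumes "simple_graph E"
  shows "(edge_ideal E :: ('v::finite, 'k::field) mpoly set) = monomial_ideal (edge_monom ` E)"
proof -
  have card2: "card e = 2" if "e \<in> E" for e
    using that assms by (simp add: simple_graph_def)
  have "{indet u * indet v | u v. {u, v} \<in> E} = (\<lambda>s. single s (1 :: 'k)) ` edge_monom ` E"
    (is "?L = ?R")
  proof
    show "?L \<subseteq> ?R"
    proof
      fix p :: "('v, 'k) mpoly" assume "p \<in> ?L"
      then obtain u v where uv: "{u, v} \<in> E" "p = indet u * indet v" by blast
      then have "u \<noteq> v" using card2[of "{u, v}"] by auto
      then have "p = single (edge_monom {u, v}) 1"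
        by (simp add: uv indet_def mult_single edge_monom_doubleton)
      then show "p \<in> ?R" using uv by blast
    qed
    show "?R \<subseteq> ?L"
    proof
      fix p :: "('v, 'k) mpoly" assume "p \<in> ?R"
      then obtain e where e: "e \<in> E" "p = single (edge_monom e) 1" by blast
      then obtain u v where uv: "e = {u, v}" "u \<noteq> v"
        using card2 by (meson card_2_iff)
      then have "p = indet u * indet v"
        by (simp add: e indet_def mult_single edge_monom_doubleton)
      with e uv show "p \<in> ?L" by blast
    qed
  qed
  then show ?thesis by (simp add: edge_ideal_def genideal_monomials)
qed

lemma ideal_power_edge_ideal:
  assumes "simple_graph E"
  shows "ideal_power mpoly_ring (edge_ideal E :: ('v::finite, 'k::field) mpoly set) k
    = monomial_ideal (edge_products E k)"
proof (induction k)
  case 0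
  show ?case by (simp add: ideal_power_def ideals_set_def monomial_ideal_def)
next
  case (Suc k)
  have "{s + t | s t. s \<in> edge_products E k \<and> t \<in> edge_monom ` E} = edge_products E (Suc k)"
    by auto
  with Suc show ?case
    by (simp add: ideal_power_def ideals_set_def edge_ideal_eq[OF assms] ideal_prod_monomial_ideal)
qed

lemma edge_products_add:
  "s \<in> edge_products E j \<Longrightarrow> t \<in> edge_products E k \<Longrightarrow> s + t \<in> edge_products E (j + k)"
proof (induction k arbitrary: t)
  case (Suc k)
  then obtain t' e where "t = t' + edge_monom e" "t' \<in> edge_products E k" "e \<in> E" by auto
  with Suc show ?case by (auto simp flip: add.assoc)
qed simp

lemma sum_edge_monom_in_edge_products:
  "finite A \<Longrightarrow> A \<subseteq> E \<Longrightarrow> sum edge_monom A \<in> edge_products E (card A)"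
proof (induction A rule: finite_induct)
  case (insert e A)
  then have "sum edge_monom A \<in> edge_products E (card A)" "e \<in> E" by auto
  with insert(1,2) show ?case
    by (auto simp: add.commute[of "edge_monom e"])
qed simp

text \<open>
  The degree with respect to the variables in \<open>Y\<close>; with \<^term>\<open>UNIV\<close> for \<open>Y\<close> it is the total degree.
\<close>

definition degree_in :: "'v set \<Rightarrow> ('v \<Rightarrow>\<^sub>0 nat) \<Rightarrow> nat" where
  "degree_in Y t = (\<Sum>v\<in>Y. lookup t v)"

lemma degree_in_add: "degree_in Y (s + t) = degree_in Y s + degree_in Y t"
  by (simp add: degree_in_def lookup_add sum.distrib)

lemma degree_in_variable: "degree_in Y (single (v :: 'v::finite) 1) = (if v \<in> Y then 1 else 0)"
  by (simp add: degree_in_def lookup_single when_def)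

lemma degree_in_edge_monom: "degree_in Y (edge_monom (e :: 'v::finite set)) = card (e \<inter> Y)"
proof -
  have "lookup (edge_monom e) v = (if v \<in> e then 1 else 0)" for v
    by (simp add: edge_monom_def lookup_sum lookup_single when_def)
  then show ?thesis
    by (simp add: degree_in_def sum.If_cases Int_commute)
qed

lemma degree_in_edge_products:
  fixes E :: "'v::finite set set"
  assumes "\<And>e. e \<in> E \<Longrightarrow> card (e \<inter> Y) = d"
  shows "s \<in> edge_products E k \<Longrightarrow> degree_in Y s = k * d"
proof (induction k arbitrary: s)
  case 0
  then show ?case by (simp add: degree_in_def)
next
  case (Suc k)
  then show ?case
    by (auto simp: degree_in_add degree_in_edge_monom assms)
qed

lemma degree_in_pos_iff: "degree_in (Y :: 'v::finite set) t > 0 \<longleftrightarrow> keys t \<inter> Y \<noteq> {}"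
  by (auto simp: degree_in_def sum_eq_0_iff in_keys_iff simp flip: neq0_conv)

lemma graded_part_iff: 
  "f \<in> graded_part d \<longleftrightarrow> (\<forall>t\<in>keys f. degree_in UNIV (t :: 'v::finite \<Rightarrow>\<^sub>0 nat) = d)"
proof -
  have "(\<Sum>v\<in>keys t. lookup t v) = degree_in UNIV t" for t :: "'v \<Rightarrow>\<^sub>0 nat"
    unfolding degree_in_def by (rule sum.mono_neutral_left) (auto simp: in_keys_iff)
  then show ?thesis by (simp add: graded_part_def)
qed

text \<open>
  A prime containing the \<open>k\<close>-th power of the product of the ends of an edge contains one of these ends,
  a form of degree one. It multiplies \<open>f\<close> into an ideal generated in degree \<open>2k\<close>.
\<close>

lemma colon_degree_lower_bound:
  fixes E :: "'v::finite set set" and f :: "('v, 'k::field) mpoly"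
  assumes E: "simple_graph E" "E \<noteq> {}"
    and f: "f \<in> graded_part d"
    and prime: "primeideal (colon_ideal mpoly_ring (monomial_ideal (edge_products E k)) f) mpoly_ring"
      (is "primeideal ?P _")
  shows "2 * k - 1 \<le> d"
proof -
  let ?I = "monomial_ideal (edge_products E k) :: ('v, 'k) mpoly set"
  have P: "g \<in> ?P \<longleftrightarrow> g * f \<in> ?I" for g
    by (simp add: colon_ideal_def)
  have proper: "1 \<notin> ?P"
    using primeideal.I_notcarr[OF prime] ideal.one_imp_carrier[OF primeideal.axioms(1)[OF prime]]
    by auto
  have pr: "a \<in> ?P \<or> b \<in> ?P" if "a * b \<in> ?P" for a b
    using primeideal.I_prime[OF prime, of a b] that by simp
  obtain e where e: "e \<in> E" using E by blast
  then obtain u v where uv: "e = {u, v}" "u \<noteq> v"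
    using E(1) by (auto simp: simple_graph_def card_2_iff)
  have "(indet u * indet v) ^ k \<in> ?I"
  proof -
    have "\<exists>s\<in>edge_products E n. (indet u * indet v :: ('v, 'k) mpoly) ^ n = single s 1" for n
    proof (induction n)
      case (Suc n)
      then obtain s where s: "s \<in> edge_products E n"
        "(indet u * indet v :: ('v, 'k) mpoly) ^ n = single s 1" by blast
      then have "(indet u * indet v :: ('v, 'k) mpoly) ^ Suc n = single (s + edge_monom e) 1"
        by (simp add: uv edge_monom_doubleton indet_def mult_single ac_simps)
      with s e show ?case by auto
    qed simp
    then show ?thesis
      using monomial_in_monomial_ideal[of _ _ 0] by (metis add.right_neutral)
  qed
  then have "(indet u * indet v) ^ k \<in> ?P"
    using ideal_mult[OF ideal_monomial_ideal, of "(indet u * indet v) ^ k" "edge_products E k" f]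
    by (simp add: P mult.commute)
  moreover have "a \<in> ?P" if "a ^ n \<in> ?P" for a n
    using that by (induction n) (use proper pr in auto)
  ultimately have "indet u * indet v \<in> ?P" by blast
  then obtain w where "indet w \<in> ?P" using pr by blast
  then have wf: "f * single (single w 1) 1 \<in> ?I"
    by (simp add: P indet_def mult.commute)
  have "f \<noteq> 0"
    using proper ideal_zero[OF ideal_monomial_ideal] by (auto simp: P)
  then obtain t where t: "t \<in> keys f" by (metis keys_eq_empty equals0I)
  then have "t + single w 1 \<in> keys (f * single (single w 1) 1)"
    by (simp add: keys_mult_monomial)
  with wf obtain s r where s: "s \<in> edge_products E k" "t + single w 1 = s + r"
    by (auto simp: monomial_ideal_def)
  have "degree_in UNIV s = k * 2"
    using E(1) by (intro degree_in_edge_products[OF _ s(1)]) (simp add: simple_graph_def)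
  moreover have "degree_in UNIV t = d"
    using f t by (simp add: graded_part_iff)
  ultimately show ?thesis
    using arg_cong[OF s(2), of "degree_in UNIV"]
    by (simp add: degree_in_add degree_in_variable del: One_nat_def)
qed


section \<open>Links along paths in a two-coloured spanning tree\<close>

text \<open>
  The trace that a walk from \<open>u\<close> to \<open>v\<close> without repeated edges leaves on exponents. In a walk
  of even length let \<open>A\<close> be the edges in odd places and \<open>B\<close> those in even places; then \<open>A\<close> covers every
  place of the walk except its end, and \<open>B\<close> every place except its start. A link keeps just the
  two families of edges to be exchanged; as they are sets, each edge is exchanged at most once.
\<close>

definition even_link :: "'v set set \<Rightarrow> 'v \<Rightarrow> 'v \<Rightarrow> bool" where
  "even_link T u v \<longleftrightarrow> (\<exists>A B. A \<subseteq> T \<and> B \<subseteq> T \<and> card A = card B \<and>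
     single u 1 + sum edge_monom B = single v 1 + sum edge_monom A)"

text \<open>
  In a walk of odd length the first and the last edge are both in odd places, so the even
  places miss both ends.
\<close>

definition odd_link :: "'v set set \<Rightarrow> 'v \<Rightarrow> 'v \<Rightarrow> bool" where
  "odd_link T u v \<longleftrightarrow> (\<exists>A B. A \<subseteq> T \<and> B \<subseteq> T \<and> card A = Suc (card B) \<and>
     single u 1 + single v 1 + sum edge_monom B = sum edge_monom A)"

lemma even_link_refl: "even_link T u u"
  unfolding even_link_def by (intro exI[of _ "{}"]) simp

lemma even_link_sym: "even_link T u v \<Longrightarrow> even_link T v u"
  unfolding even_link_def by metis

lemma odd_link_sym: "odd_link T u v \<Longrightarrow> odd_link T v u"
  unfolding odd_link_def by (metis add.commute)

lemma even_link_mono: "even_link T u v \<Longrightarrow> T \<subseteq> T' \<Longrightarrow> even_link T' u v"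
  unfolding even_link_def by (meson order_trans)

lemma odd_link_mono: "odd_link T u v \<Longrightarrow> T \<subseteq> T' \<Longrightarrow> odd_link T' u v"
  unfolding odd_link_def by (meson order_trans)

text \<open>
  The walk is prolonged by a new edge, which takes an even place here and an odd place in the next lemma.
\<close>

lemma odd_link_extend:
  fixes T :: "'v::finite set set"
  assumes "odd_link T u v" "{v, w} \<notin> T" "v \<noteq> w"
  shows "even_link (insert {v, w} T) u w"
proof -
  from assms obtain A B where AB: "A \<subseteq> T" "B \<subseteq> T" "card A = Suc (card B)"
    "single u 1 + single v 1 + sum edge_monom B = sum edge_monom A"
    unfolding odd_link_def by blast
  have "{v, w} \<notin> B" "finite B" using AB assms by auto
  then have "single u 1 + sum edge_monom (insert {v, w} B) = single w 1 + sum edge_monom A"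
    using AB(4) assms(3) by (simp add: edge_monom_doubleton ac_simps flip: AB(4))
  moreover have "card A = card (insert {v, w} B)"
    using \<open>{v, w} \<notin> B\<close> \<open>finite B\<close> AB(3) by simp
  ultimately show ?thesis
    using AB(1,2) unfolding even_link_def
    by (intro exI[of _ A] exI[of _ "insert {v, w} B"]) auto
qed

lemma even_link_extend:
  fixes T :: "'v::finite set set"
  assumes "even_link T u v" "{v, w} \<notin> T" "v \<noteq> w"
  shows "odd_link (insert {v, w} T) u w"
proof -
  from assms obtain A B where AB: "A \<subseteq> T" "B \<subseteq> T" "card A = card B"
    "single u 1 + sum edge_monom B = single v 1 + sum edge_monom A"
    unfolding even_link_def by blast
  have new: "{v, w} \<notin> A" "finite A" using AB assms by auto
  have "single u 1 + single w 1 + sum edge_monom B = (single u 1 + sum edge_monom B) + single w 1"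
    by (simp add: ac_simps)
  also have "\<dots> = sum edge_monom (insert {v, w} A)"
    using new assms(3) by (simp only: AB(4)) (simp add: edge_monom_doubleton ac_simps)
  finally have "single u 1 + single w 1 + sum edge_monom B = sum edge_monom (insert {v, w} A)" .
  moreover have "card (insert {v, w} A) = Suc (card B)"
    using new AB(3) by simp
  ultimately show ?thesis
    using AB(1,2) unfolding odd_link_def
    by (intro exI[of _ B] exI[of _ "insert {v, w} A"]) auto
qed

definition coloured_link :: "('v \<Rightarrow> bool) \<Rightarrow> 'v set set \<Rightarrow> 'v \<Rightarrow> 'v \<Rightarrow> bool" where
  "coloured_link c T u v \<longleftrightarrow> (if c u = c v then even_link T u v else odd_link T u v)"

text \<open>
  What holds of a tree \<open>T\<close> on the vertex set \<open>W\<close> with its proper two-colouring \<open>c\<close>: the path between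
  two vertices is a link inside \<open>T\<close>, of the parity that their colours prescribe.
\<close>

definition coloured_tree :: "'v set set \<Rightarrow> ('v \<Rightarrow> bool) \<Rightarrow> 'v set \<Rightarrow> 'v set set \<Rightarrow> bool" where
  "coloured_tree E c W T \<longleftrightarrow> T \<subseteq> E \<and> \<Union>T \<subseteq> W \<and>
     (\<forall>u v. {u, v} \<in> T \<longrightarrow> c u \<noteq> c v) \<and> (\<forall>u\<in>W. \<forall>v\<in>W. coloured_link c T u v)"

text \<open>
  A path to the leaf \<open>z\<close> ends with the edge \<open>{y, z}\<close>, and this edge is new to the tree because \<open>z\<close> is.
\<close>

lemma coloured_tree_add_leaf:
  fixes E :: "'v::finite set set"
  assumes tree: "coloured_tree E c W T" and y: "y \<in> W" and z: "z \<notin> W" and e: "{y, z} \<in> E"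
  shows "coloured_tree E (c(z := \<not> c y)) (insert z W) (insert {y, z} T)"
proof -
  let ?c = "c(z := \<not> c y)" and ?T = "insert {y, z} T"
  have TE: "T \<subseteq> E" and TW: "\<Union>T \<subseteq> W" and proper: "\<And>u v. {u, v} \<in> T \<Longrightarrow> c u \<noteq> c v"
    and link: "\<And>u v. u \<in> W \<Longrightarrow> v \<in> W \<Longrightarrow> coloured_link c T u v"
    using tree by (auto simp: coloured_tree_def)
  have yz: "y \<noteq> z" "{y, z} \<notin> T" using y z TW by auto
  have old: "coloured_link ?c ?T u v" if "u \<in> W" "v \<in> W" for u v
  proof -
    from that z have "?c u = c u" "?c v = c v" by auto
    then show ?thesis
      using link[OF that] even_link_mono[OF _ subset_insertI] odd_link_mono[OF _ subset_insertI]
      unfolding coloured_link_def by metis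
  qed
  have new: "coloured_link ?c ?T u z" if "u \<in> W" for u
    using link[OF that y] that z yz even_link_extend[of T u y z] odd_link_extend[of T u y z]
    by (auto simp: coloured_link_def split: if_splits)
  have new': "coloured_link ?c ?T z u" if "u \<in> W" for u
    using new[OF that] even_link_sym[of ?T u z] odd_link_sym[of ?T u z]
    unfolding coloured_link_def by metis
  have "coloured_link ?c ?T z z"
    by (simp add: coloured_link_def even_link_refl)
  with old new new' have "\<forall>u\<in>insert z W. \<forall>v\<in>insert z W. coloured_link ?c ?T u v"
    by blast
  moreover have "?c u \<noteq> ?c v" if "{u, v} \<in> ?T" for u v
  proof (cases "{u, v} = {y, z}")
    case True
    with yz show ?thesis by (auto simp: doubleton_eq_iff)
  next
    case False
    with that have "{u, v} \<in> T" by blast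
    with proper[OF this] TW z show ?thesis by auto
  qed
  ultimately show ?thesis
    using TE TW e y unfolding coloured_tree_def by auto
qed

text \<open>
  A path from inside \<open>W\<close> to outside must cross the boundary.
\<close>

lemma connected_graph_boundary_edge:
  assumes "connected_graph E" and "w \<in> W" and "W \<noteq> UNIV"
  obtains y z where "y \<in> W" "z \<notin> W" "{y, z} \<in> E"
proof -
  from assms(3) obtain v where v: "v \<notin> W" by blast
  have "(w, v) \<in> {(x, y). {x, y} \<in> E}\<^sup>*"
    using assms(1) by (simp add: connected_graph_def)
  then have "v \<in> W \<or> (\<exists>y z. y \<in> W \<and> z \<notin> W \<and> {y, z} \<in> E)"
    by induction (use assms(2) in auto)
  with v that show thesis by blast
qed

text \<open>
  Grow a tree leaf by leaf from a single vertex; connectedness provides the next leaf.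
\<close>

lemma spanning_coloured_tree:
  fixes E :: "'v::finite set set"
  assumes "connected_graph E"
  shows "\<exists>c T. coloured_tree E c UNIV T"
proof -
  have "\<exists>c W T. card W = Suc n \<and> coloured_tree E c W T" if "n < card (UNIV :: 'v set)" for n
    using that
  proof (induction n)
    case 0
    have "coloured_tree E (\<lambda>_. True) {undefined} {}"
      by (auto simp: coloured_tree_def coloured_link_def even_link_refl)
    then show ?case
      by (intro exI[of _ "\<lambda>_. True"] exI[of _ "{undefined}"] exI[of _ "{}"]) simp
  next
    case (Suc n)
    then obtain c W T where W: "card W = Suc n" "coloured_tree E c W T" by auto
    then have "W \<noteq> UNIV" using Suc.prems by auto
    moreover obtain w where "w \<in> W" using W(1) by fastforce
    ultimately obtain y z where "y \<in> W" "z \<notin> W" "{y, z} \<in> E"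
      using connected_graph_boundary_edge[OF assms] by metis
    then have "coloured_tree E (c(z := \<not> c y)) (insert z W) (insert {y, z} T)"
      and "card (insert z W) = Suc (Suc n)"
      using W coloured_tree_add_leaf by auto
    then show ?case by blast
  qed
  from this[of "card (UNIV :: 'v set) - 1"] obtain c W T
    where "card W = card (UNIV :: 'v set)" "coloured_tree E c W T"
    using finite_UNIV_card_ge_0[where 'a='v] by auto
  moreover from this(1) have "W = UNIV" by (simp add: card_eq_UNIV_imp_eq_UNIV)
  ultimately show ?thesis by blast
qed

text \<open>
  The two cases of the upper bound in one statement: \<open>Y\<close> is a colour class not containing \<open>x\<close> and
  \<open>d = 1\<close> when the graph is bipartite, and \<open>Y\<close> is the whole vertex set and \<open>d = 2\<close> when it is not. The
  last inequality makes \<open>x\<close> times a product of \<open>k - 1\<close> edges too small in degree to be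
  divisible by a product of \<open>k\<close> edges.
\<close>

lemma odd_links_from_vertex:
  fixes E :: "'v::finite set set"
  assumes E: "simple_graph E" "connected_graph E"
  obtains x Y d where "\<And>y. y \<in> Y \<Longrightarrow> odd_link E x y"
    and "\<And>e. e \<in> E \<Longrightarrow> card (e \<inter> Y) = d"
    and "degree_in Y (single x 1) < d"
proof -
  obtain c T where "coloured_tree E c UNIV T"
    using spanning_coloured_tree[OF E(2)] by blast
  then have TE: "T \<subseteq> E" and proper: "\<And>u v. {u, v} \<in> T \<Longrightarrow> c u \<noteq> c v"
    and link: "\<And>u v. coloured_link c T u v"
    by (auto simp: coloured_tree_def)
  have card2: "card e = 2" if "e \<in> E" for e
    using that E(1) by (simp add: simple_graph_def)
  show thesis
  proof (cases "\<exists>a b. {a, b} \<in> E \<and> c a = c b")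
    case True
    then obtain a b where ab: "{a, b} \<in> E" "c a = c b" by blast
    have "a \<noteq> b" using card2[OF ab(1)] by auto
    \<comment> \<open>a vertex of the colour of \<open>a\<close> is reached through \<open>b\<close>: the edge \<open>{a, b}\<close> is not in the tree,
      since its ends have the same colour\<close>
    have "odd_link E a y" for y
    proof (cases "c y = c a")
      case True
      then have "even_link T y b" using link[of y b] ab by (simp add: coloured_link_def)
      then have "odd_link (insert {b, a} T) y a"
        using proper[of b a] ab \<open>a \<noteq> b\<close> by (intro even_link_extend) auto
      moreover have "insert {b, a} T \<subseteq> E" using TE ab by (simp add: insert_commute)
      ultimately show ?thesis using odd_link_sym odd_link_mono by metis
    next
      case False
      then have "odd_link T a y" using link[of a y] by (auto simp: coloured_link_def)
      then show ?thesis using TE by (rule odd_link_mono)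
    qed
    then show thesis
      by (intro that[of UNIV a 2]) (auto simp: card2 degree_in_variable simp del: One_nat_def)
  next
    case False
    \<comment> \<open>in a bipartite graph any vertex serves as starting point\<close>
    define x :: 'v where "x = undefined"
    show thesis
    proof (rule that[of "{v. c v \<noteq> c x}" x 1])
      fix y assume "y \<in> {v. c v \<noteq> c x}"
      then have "odd_link T x y" using link[of x y] by (auto simp: coloured_link_def)
      then show "odd_link E x y" using TE by (rule odd_link_mono)
    next
      fix e assume e: "e \<in> E"
      then obtain u v where "e = {u, v}" "u \<noteq> v" using card2 by (meson card_2_iff)
      with False e have "e \<inter> {v. c v \<noteq> c x} = (if c u = c x then {v} else {u})" by auto
      then show "card (e \<inter> {v. c v \<noteq> c x}) = 1" by simp
    next
      show "degree_in {v. c v \<noteq> c x} (single x 1) < 1"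
        by (subst degree_in_variable) simp
    qed
  qed
qed

section \<open>The v-number of high powers of the edge ideal\<close>

text \<open>
  The exchange of edges: replace \<open>B\<close>, which is contained in \<open>E\<close>, by \<open>A\<close>, which has one edge more and
  absorbs the two vertices \<open>x\<close> and \<open>y\<close>.
\<close>

lemma odd_link_product:
  fixes E :: "'v::finite set set"
  assumes "odd_link E x y"
  shows "single x 1 + single y 1 + sum edge_monom E \<in> edge_products E (Suc (card E))"
proof -
  from assms obtain A B where AB: "A \<subseteq> E" "B \<subseteq> E" "card A = Suc (card B)"
    "single x 1 + single y 1 + sum edge_monom B = sum edge_monom A"
    unfolding odd_link_def by blast
  have "sum edge_monom E = sum edge_monom B + sum edge_monom (E - B)"
    using AB(2) by (simp add: sum.subset_diff[of B E] add.commute)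
  then have "single x 1 + single y 1 + sum edge_monom E = sum edge_monom A + sum edge_monom (E - B)"
    by (simp flip: AB(4) add: ac_simps)
  moreover have "sum edge_monom A + sum edge_monom (E - B) \<in> edge_products E (card A + card (E - B))"
    using AB(1) by (intro edge_products_add sum_edge_monom_in_edge_products) auto
  moreover have "card A + card (E - B) = Suc (card E)"
    using AB(2,3) card_mono[OF _ AB(2)] by (simp add: card_Diff_subset)
  ultimately show ?thesis by simp
qed

text \<open>
  The monomial \<open>s\<close> is the \<open>f\<close> of the upper bound. The exchange shows that multiplication by any
  variable of \<open>Y\<close> leads into \<open>I(G)\<^sup>k\<close>, and the degree in \<open>Y\<close> shows that nothing else does.
\<close>

lemma exists_colon_variables:
  fixes E :: "'v::finite set set"
  assumes E: "simple_graph E" "connected_graph E" "E \<noteq> {}" and k: "card E + 1 \<le> k"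
  obtains s Y where "degree_in UNIV s = 2 * k - 1"
    and "\<And>t. (\<exists>r\<in>edge_products E k. \<exists>q. t + s = r + q) \<longleftrightarrow> keys t \<inter> Y \<noteq> {}"
proof -
  obtain x Y d where link: "\<And>y. y \<in> Y \<Longrightarrow> odd_link E x y"
    and d: "\<And>e. e \<in> E \<Longrightarrow> card (e \<inter> Y) = d" and x: "degree_in Y (single x 1) < d"
    using odd_links_from_vertex[OF E(1,2)] by metis
  obtain e where e: "e \<in> E" using E(3) by blast
  define n where "n = k - 1 - card E"
  \<comment> \<open>an arbitrary product of edges fills up the degree\<close>
  have "\<exists>p. p \<in> edge_products E n" for n
    using e by (induction n) auto
  then obtain p where p: "p \<in> edge_products E n" by blast
  define q where "q = sum edge_monom E + p"
  define s where "s = single x 1 + q"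
  have "q \<in> edge_products E (card E + n)"
    unfolding q_def using p by (intro edge_products_add sum_edge_monom_in_edge_products) auto
  moreover have k': "Suc (card E) + n = k" "card E + n = k - 1"
    using k by (simp_all add: n_def)
  ultimately have q: "q \<in> edge_products E (k - 1)" by simp
  show thesis
  proof (rule that[of s Y])
    have "degree_in UNIV q = (k - 1) * 2"
      using E(1) by (intro degree_in_edge_products[OF _ q]) (simp add: simple_graph_def)
    then show "degree_in UNIV s = 2 * k - 1"
      using k by (simp add: s_def degree_in_add degree_in_variable del: One_nat_def)
  next
    fix t
    show "(\<exists>r\<in>edge_products E k. \<exists>q. t + s = r + q) \<longleftrightarrow> keys t \<inter> Y \<noteq> {}"
    proof
      assume "\<exists>r\<in>edge_products E k. \<exists>q. t + s = r + q"
      then obtain r u where r: "r \<in> edge_products E k" "t + s = r + u" by blast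
      have "degree_in Y r = k * d" "degree_in Y q = (k - 1) * d"
        using degree_in_edge_products[OF d r(1)] degree_in_edge_products[OF d q] by simp_all
      moreover have "k * d = (k - 1) * d + d"
        using k by (cases k) auto
      ultimately have "degree_in Y t > 0"
        using arg_cong[OF r(2), of "degree_in Y"] x by (simp add: s_def degree_in_add)
      then show "keys t \<inter> Y \<noteq> {}" by (simp add: degree_in_pos_iff)
    next
      assume "keys t \<inter> Y \<noteq> {}"
      then obtain y where y: "y \<in> Y" "lookup t y \<noteq> 0"
        by (auto simp: in_keys_iff)
      then have t: "t = single y 1 + (t - single y 1)"
        by (intro poly_mapping_eqI) (auto simp: lookup_add lookup_minus lookup_single when_def)
      let ?r = "single x 1 + single y 1 + sum edge_monom E + p"
      have "?r \<in> edge_products E k"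
        using edge_products_add[OF odd_link_product[OF link[OF y(1)]] p] unfolding k'(1) .
      moreover have "t + s = ?r + (t - single y 1)"
        by (subst t) (simp add: s_def q_def ac_simps)
      ultimately show "\<exists>r\<in>edge_products E k. \<exists>q. t + s = r + q" by blast
    qed
  qed
qed

theorem theorem5p1:
  fixes E :: "'v::finite set set" and m k :: nat
  assumes "simple_graph E"
    and "connected_graph E"
    and "card E = m" and "m \<ge> 1"
    and "k \<ge> m + 1"
  shows "v_number (ideal_power mpoly_ring (edge_ideal E :: ('v, 'k::field) mpoly set) k)
    = enat (2 * k - 1)"
proof -
  let ?I = "monomial_ideal (edge_products E k) :: ('v, 'k) mpoly set"
  have E: "E \<noteq> {}" using assms(3,4) by auto
  obtain s Y where s: "degree_in UNIV s = 2 * k - 1"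
    and colon: "\<And>t. (\<exists>r\<in>edge_products E k. \<exists>q. t + s = r + q) \<longleftrightarrow> keys t \<inter> Y \<noteq> {}"
    using exists_colon_variables[OF assms(1,2) E] assms(3,5) by metis
  let ?f = "single s 1 :: ('v, 'k) mpoly"
  have "primeideal (colon_ideal mpoly_ring ?I ?f) mpoly_ring"
    by (simp add: colon_monomial_ideal colon primeideal_variables)
  then have "colon_ideal mpoly_ring ?I ?f \<in> associated_primes mpoly_ring ?I"
    by (auto simp: associated_primes_def)
  moreover have "?f \<in> graded_part (2 * k - 1)"
    by (simp add: graded_part_iff s)
  ultimately have "v_number ?I \<le> enat (2 * k - 1)"
    unfolding v_number_def by (intro Inf_lower) auto
  moreover have "enat (2 * k - 1) \<le> v_number ?I"
    unfolding v_number_def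
  proof (rule Inf_greatest)
    fix n assume "n \<in> {enat d |d. \<exists>f\<in>graded_part d.
      \<exists>P\<in>associated_primes mpoly_ring ?I. colon_ideal mpoly_ring ?I f = P}"
    then obtain d f where "n = enat d" "f \<in> graded_part d"
      "primeideal (colon_ideal mpoly_ring ?I f) mpoly_ring"
      by (auto simp: associated_primes_def)
    with colon_degree_lower_bound[OF assms(1) E] show "enat (2 * k - 1) \<le> n"
      by simp
  qed
  ultimately show ?thesis
    by (simp add: ideal_power_edge_ideal[OF assms(1)])
qed

end
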